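(* Let $\mathbb{T}$ be a time scale, let $a,b\in\mathbb{T}$ with $a<b$, and let $[a,b]$ denote $\{t\in\mathbb{T}: a\le t\le b\}$. Let $f:[a,b]\to\mathbb{R}$ be $\Delta$-differentiable with rd-continuous derivative $f^\Delta$, and let $\gamma,\Gamma\in\mathbb{R}$ be such that $\gamma\le f^\Delta(t)\le\Gamma$ for all $t\in[a,b]$ (at which $f^\Delta$ is defined, i.e. $t\in[a,b]^\kappa$). Then for all $t\in[a,b]$, $$\left|f(t)-\frac{1}{b-a}\int_a^b f^\sigma(s)\,\Delta s-\frac{f(b)-f(a)}{(b-a)^2}\bigl(h_2(t,a)-h_2(t,b)\bigr)\right|\le\frac14(b-a)(\Gamma-\gamma).$$
   Context: A time scale $\mathbb{T}$ is a nonempty closed subset of $\mathbb{R}$; intervals are intersected with $\mathbb{T}$. The forward jump operator is $\sigma(t)=\inf\{s\in\mathbb{T}:s>t\}$ and the backward jump operator is $\rho(t)=\sup\{s\in\mathbb{T}:s<t\}$ (with $\sigma(\max)=\max$, $\rho(\min)=\min$); $f^\sigma(t)=f(\sigma(t))$. A point $t$ is right-scattered if $\sigma(t)>t$, right-dense if $\sigma(t)=t$, left-scattered if $\rho(t)<t$, left-dense if $\rho(t)=t$. $\mathbb{T}^\kappa$ is $\mathbb{T}$ minus its maximum if that maximum exists and is left-scattered, and $\mathbb{T}^\kappa=\mathbb{T}$ otherwise. For functions on $[a,b]$, these notions are taken with respect to the time scale $[a,b]$. For $t\in\mathbb{T}^\kappa$, the $\Delta$-derivative $f^\Delta(t)$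 is the number (if it exists) such that for every $\varepsilon>0$ there is a neighborhood $U$ of $t$ in $\mathbb{T}$ with $|f(\sigma(t))-f(s)-f^\Delta(t)(\sigma(t)-s)|\le\varepsilon|\sigma(t)-s|$ for all $s\in U$; $f$ is $\Delta$-differentiable if $f^\Delta(t)$ exists for all $t\in\mathbb{T}^\kappa$. A function is rd-continuous if it is continuous at each right-dense point or maximal element and has a (finite) left-sided limit at each left-dense point. Every rd-continuous $g$ has a $\Delta$-antiderivative $G$ ($G^\Delta=g$ on $\mathbb{T}^\kappa$), and $\int_c^d g(t)\,\Delta t=G(d)-G(c)$. The functions $h_k:\mathbb{T}^2\to\mathbb{R}$ are $h_0(t,s)=1$, $h_{k+1}(t,s)=\int_s^t h_k(\tau,s)\,\Delta\tau$; thus $h_1(t,s)=t-s$ and $h_2(t,s)=\int_s^t(\tau-s)\,\Delta\tau$. *)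

theory Defs
  imports "HOL-Analysis.Analysis"
begin

definition time_scale :: "real set \<Rightarrow> bool" where
  "time_scale T \<longleftrightarrow> T \<noteq> {} \<and> closed T"

text \<open>All notions take the time scale as an explicit parameter, so that they can be
  applied both to the ambient time scale and to a time-scale interval of it.\<close>

definition fwd_jump :: "real set \<Rightarrow> real \<Rightarrow> real" where
  "fwd_jump T t = (if \<exists>s\<in>T. t < s then Inf {s \<in> T. t < s} else t)"

definition bwd_jump :: "real set \<Rightarrow> real \<Rightarrow> real" where
  "bwd_jump T t = (if \<exists>s\<in>T. s < t then Sup {s \<in> T. s < t} else t)"

definition right_dense :: "real set \<Rightarrow> real \<Rightarrow> bool" where
  "right_dense T t \<longleftrightarrow> fwd_jump T t = t"

definition left_dense :: "real set \<Rightarrow> real \<Rightarrow> bool" where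
  "left_dense T t \<longleftrightarrow> bwd_jump T t = t"

definition left_scattered :: "real set \<Rightarrow> real \<Rightarrow> bool" where
  "left_scattered T t \<longleftrightarrow> bwd_jump T t < t"

definition is_maximum :: "real set \<Rightarrow> real \<Rightarrow> bool" where
  "is_maximum T t \<longleftrightarrow> t \<in> T \<and> (\<forall>s\<in>T. s \<le> t)"

definition kappa :: "real set \<Rightarrow> real set" where
  "kappa T = {t \<in> T. \<not> (is_maximum T t \<and> left_scattered T t)}"

text \<open>The point \<open>t\<close> itself belongs to the neighbourhood; this is what determines the
  derivative at right-scattered points (so \<open>at t within T\<close> cannot be used here).\<close>

definition has_delta_derivative ::
    "real set \<Rightarrow> (real \<Rightarrow> real) \<Rightarrow> real \<Rightarrow> real \<Rightarrow> bool" where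
  "has_delta_derivative T f D t \<longleftrightarrow>
     (\<forall>\<epsilon>>0. \<exists>U. open U \<and> t \<in> U \<and>
        (\<forall>s\<in>U \<inter> T. \<bar>f (fwd_jump T t) - f s - D * (fwd_jump T t - s)\<bar>
                      \<le> \<epsilon> * \<bar>fwd_jump T t - s\<bar>))"

definition delta_differentiable :: "real set \<Rightarrow> (real \<Rightarrow> real) \<Rightarrow> bool" where
  "delta_differentiable T f \<longleftrightarrow> (\<forall>t\<in>kappa T. \<exists>D. has_delta_derivative T f D t)"

text \<open>Only meaningful at points of \<open>kappa T\<close>, where the derivative is unique.\<close>

definition delta_deriv :: "real set \<Rightarrow> (real \<Rightarrow> real) \<Rightarrow> real \<Rightarrow> real" where
  "delta_deriv T f t = (THE D. has_delta_derivative T f D t)"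

text \<open>Here \<open>S\<close> is the domain of \<open>g\<close> (\<open>T\<close> or, for a derivative, \<open>kappa T\<close>), while density
  of points refers to \<open>T\<close>. At the minimum of \<open>T\<close> the left-sided limit is
  vacuous, since the limiting filter is trivial there.\<close>

definition rd_continuous_on :: "real set \<Rightarrow> real set \<Rightarrow> (real \<Rightarrow> real) \<Rightarrow> bool" where
  "rd_continuous_on T S g \<longleftrightarrow>
     (\<forall>t\<in>S. (right_dense T t \<or> is_maximum T t \<longrightarrow> continuous (at t within S) g) \<and>
            (left_dense T t \<longrightarrow> (\<exists>L. (g \<longlongrightarrow> L) (at t within (S \<inter> {..<t})))))"

definition delta_antiderivative ::
    "real set \<Rightarrow> (real \<Rightarrow> real) \<Rightarrow> (real \<Rightarrow> real) \<Rightarrow> bool" where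
  "delta_antiderivative T g G \<longleftrightarrow> (\<forall>t\<in>kappa T. has_delta_derivative T G (g t) t)"

text \<open>Antiderivatives on \<open>T\<close> are unique up to an additive constant, so for \<open>c, d \<in> T\<close> the
  value does not depend on the antiderivative, whenever one exists.\<close>

definition delta_integral ::
    "real set \<Rightarrow> (real \<Rightarrow> real) \<Rightarrow> real \<Rightarrow> real \<Rightarrow> real" where
  "delta_integral T g c d = (THE I. \<exists>G. delta_antiderivative T g G \<and> I = G d - G c)"

primrec ts_h :: "real set \<Rightarrow> nat \<Rightarrow> real \<Rightarrow> real \<Rightarrow> real" where
  "ts_h T 0 = (\<lambda>t s. 1)"
| "ts_h T (Suc k) = (\<lambda>t s. delta_integral T (\<lambda>\<tau>. ts_h T k \<tau> s) s t)"

end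

(* With m = (f b - f a) / (b - a) and k s = f s - m * s we have k a = k b, and (s^2)^Delta =
   s + sigma(s) turns the expression to be estimated into k t minus the Delta-average of
   k o sigma over [a,b].  No integral estimate is needed: |k t - k s| <= (b-a)(Gamma-gamma)/4 holds
   pointwise, because [a,b] with its end points identified is a circle of length L = b - a on
   which t and s are joined by two arcs, of lengths u and L - u.  Bounding k along both gives
   L |k t - k s| <= (Gamma-gamma) u (L-u) <= (Gamma-gamma) L^2/4.

   The integral of f o sigma exists since f s - gamma * s is nondecreasing, hence so is its
   composition with sigma; for a nondecreasing g on T an antiderivative is the ordinary integral
   of x |-> g (sup {s in T. s <= x}). *)

theory Submission
  imports Defs
begin

section \<open>The forward jump operator\<close>

lemma fwd_jump_ge: "t \<le> fwd_jump T t"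
  unfolding fwd_jump_def by (auto intro!: cInf_greatest)

lemma fwd_jump_le:
  assumes "s \<in> T" "t < s"
  shows "fwd_jump T t \<le> s"
proof -
  have "bdd_below {s \<in> T. t < s}" by (rule bdd_belowI[of _ t]) auto
  then show ?thesis using assms unfolding fwd_jump_def by (auto intro: cInf_lower)
qed

lemma fwd_jump_in:
  assumes "closed T" "t \<in> T"
  shows "fwd_jump T t \<in> T"
proof (cases "\<exists>s\<in>T. t < s")
  case True
  have "bdd_below {s \<in> T. t < s}" by (rule bdd_belowI[of _ t]) auto
  then have "Inf {s \<in> T. t < s} \<in> closure {s \<in> T. t < s}"
    using True by (intro closure_contains_Inf) auto
  also have "\<dots> \<subseteq> T" using assms(1) by (intro closure_minimal) auto
  finally show ?thesis using True by (simp add: fwd_jump_def)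
qed (use assms in \<open>auto simp: fwd_jump_def\<close>)

lemma fwd_jump_mono:
  assumes "closed T" "s \<in> T" "t \<in> T" "s \<le> t"
  shows "fwd_jump T s \<le> fwd_jump T t"
  using assms fwd_jump_le[of t T s] fwd_jump_ge[of t T] by (cases "s = t") auto

lemma fwd_jump_eqD:
  assumes "fwd_jump T t = t" "s \<in> T" "t < s" "0 < e"
  obtains r where "r \<in> T" "t < r" "r < t + e"
proof -
  have "Inf {s \<in> T. t < s} < t + e"
    using assms by (auto simp: fwd_jump_def split: if_splits)
  then obtain r where "r \<in> {s \<in> T. t < s}" "r < t + e"
    using cInf_lessD[of "{s \<in> T. t < s}"] assms by auto
  then show ?thesis using that by auto
qed

text \<open>Since \<open>b\<close> is a point of both sets beyond \<open>t\<close>, points of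
  \<open>T\<close> beyond \<open>b\<close> cannot change the infimum, and points below
  \<open>a\<close> do not compete because \<open>a \<le> t\<close>. At \<open>b\<close> itself the
  truncated jump may be smaller, hence the strict bound.\<close>

lemma fwd_jump_Int:
  assumes "closed T" "b \<in> T" "a \<le> t" "t < b"
  shows "fwd_jump (T \<inter> {a..b}) t = fwd_jump T t"
proof (rule antisym)
  have "fwd_jump T t \<le> s" if "s \<in> T \<inter> {a..b}" "t < s" for s
    using that fwd_jump_le by auto
  then have "fwd_jump T t \<le> Inf {s \<in> T \<inter> {a..b}. t < s}"
    using assms by (intro cInf_greatest) auto
  then show "fwd_jump T t \<le> fwd_jump (T \<inter> {a..b}) t"
    using assms by (auto simp: fwd_jump_def)
  have "fwd_jump (T \<inter> {a..b}) t \<le> s" if "s \<in> T" "t < s" for s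
  proof (cases "s \<le> b")
    case True
    then show ?thesis using that assms by (intro fwd_jump_le) auto
  next
    case False
    moreover have "fwd_jump (T \<inter> {a..b}) t \<le> b"
      using assms by (intro fwd_jump_le) auto
    ultimately show ?thesis by simp
  qed
  then have "fwd_jump (T \<inter> {a..b}) t \<le> Inf {s \<in> T. t < s}"
    using assms by (intro cInf_greatest) auto
  then show "fwd_jump (T \<inter> {a..b}) t \<le> fwd_jump T t"
    using assms by (auto simp: fwd_jump_def)
qed

text \<open>From below, the jump of \<open>s\<close> is at least \<open>s\<close>. From above,
  points left of some \<open>r\<close> in \<open>T\<close> jump at most to \<open>r\<close>;
  right-density supplies such an \<open>r\<close> just above \<open>t\<close>, unless
  \<open>t\<close> is the maximum, and then no jump exceeds \<open>t\<close>.\<close>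

lemma continuous_fwd_jump:
  assumes "closed T" "t \<in> T" "fwd_jump T t = t"
  shows "continuous (at t within T) (fwd_jump T)"
  unfolding continuous_within_eps_delta
proof (intro allI impI)
  fix e :: real assume "0 < e"
  obtain d where d: "0 < d" "\<And>s. s \<in> T \<Longrightarrow> s < t + d \<Longrightarrow> fwd_jump T s < t + e"
  proof (cases "\<exists>s\<in>T. t < s")
    case True
    then obtain r where r: "r \<in> T" "t < r" "r < t + e"
      using fwd_jump_eqD[OF assms(3)] \<open>0 < e\<close> by metis
    have "fwd_jump T s \<le> r" if "s \<in> T" "s < r" for s
      using fwd_jump_le r that by blast
    then show ?thesis using that[of "r - t"] r by force
  next
    case False
    have "fwd_jump T s \<le> t" if "s \<in> T" for s
      using False fwd_jump_in[OF assms(1) that] by force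
    then show ?thesis using that[of 1] \<open>0 < e\<close> by force
  qed
  have "dist (fwd_jump T s) (fwd_jump T t) < e" if "s \<in> T" "dist s t < min d e" for s
    using d(2)[OF that(1)] that(2) fwd_jump_ge[of s T] assms(3) unfolding dist_real_def by linarith
  then show "\<exists>d>0. \<forall>s\<in>T. dist s t < d \<longrightarrow> dist (fwd_jump T s) (fwd_jump T t) < e"
    using d(1) \<open>0 < e\<close> by (intro exI[of _ "min d e"]) auto
qed

section \<open>Calculus rules for the delta derivative\<close>

lemma has_delta_derivative_iff:
  "has_delta_derivative T f D t \<longleftrightarrow>
     (\<forall>e>0. \<exists>d>0. \<forall>s\<in>T. \<bar>s - t\<bar> < d \<longrightarrow>
        \<bar>f (fwd_jump T t) - f s - D * (fwd_jump T t - s)\<bar> \<le> e * \<bar>fwd_jump T t - s\<bar>)"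
  (is "_ = (\<forall>e>0. \<exists>d>0. \<forall>s\<in>T. _ \<longrightarrow> ?P e s)")
proof -
  have "(\<exists>U. open U \<and> t \<in> U \<and> (\<forall>s\<in>U \<inter> T. ?P e s)) \<longleftrightarrow>
        (\<exists>d>0. \<forall>s\<in>T. \<bar>s - t\<bar> < d \<longrightarrow> ?P e s)" (is "?L = ?R") for e
  proof
    assume ?L
    then obtain U where U: "open U" "t \<in> U" "\<forall>s\<in>U \<inter> T. ?P e s" by blast
    then obtain d where "0 < d" "\<forall>s. dist s t < d \<longrightarrow> s \<in> U"
      by (auto simp: open_dist)
    then show ?R using U by (intro exI[of _ d]) (auto simp: dist_real_def)
  next
    assume ?R
    then obtain d where "0 < d" "\<forall>s\<in>T. \<bar>s - t\<bar> < d \<longrightarrow> ?P e s" by blast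
    then show ?L
      by (intro exI[of _ "ball t d"]) (auto simp: dist_real_def abs_minus_commute)
  qed
  then show ?thesis unfolding has_delta_derivative_def by simp
qed

text \<open>This one form serves for all linear combinations below; differences are therefore
  written with a factor \<open>(- 1)\<close>.\<close>

lemma has_delta_derivative_lin:
  assumes "has_delta_derivative T f D t" "has_delta_derivative T g E t"
  shows "has_delta_derivative T (\<lambda>s. f s + c * g s) (D + c * E) t"
  unfolding has_delta_derivative_iff
proof (intro allI impI)
  let ?\<sigma> = "fwd_jump T t"
  fix e :: real assume "0 < e"
  define e' where "e' = e / (1 + \<bar>c\<bar>)"
  have "0 < e'" using \<open>0 < e\<close> by (auto simp: e'_def intro!: divide_pos_pos)
  obtain d1 where d1: "0 < d1"
    "\<And>s. s \<in> T \<Longrightarrow> \<bar>s - t\<bar> < d1 \<Longrightarrow> \<bar>f ?\<sigma> - f s - D * (?\<sigma> - s)\<bar> \<le> e' * \<bar>?\<sigma> - s\<bar>"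
    using assms(1) \<open>0 < e'\<close> unfolding has_delta_derivative_iff by metis
  obtain d2 where d2: "0 < d2"
    "\<And>s. s \<in> T \<Longrightarrow> \<bar>s - t\<bar> < d2 \<Longrightarrow> \<bar>g ?\<sigma> - g s - E * (?\<sigma> - s)\<bar> \<le> e' * \<bar>?\<sigma> - s\<bar>"
    using assms(2) \<open>0 < e'\<close> unfolding has_delta_derivative_iff by metis
  show "\<exists>d>0. \<forall>s\<in>T. \<bar>s - t\<bar> < d \<longrightarrow>
    \<bar>(f ?\<sigma> + c * g ?\<sigma>) - (f s + c * g s) - (D + c * E) * (?\<sigma> - s)\<bar> \<le> e * \<bar>?\<sigma> - s\<bar>"
  proof (intro exI[of _ "min d1 d2"] conjI ballI impI)
    fix s assume s: "s \<in> T" "\<bar>s - t\<bar> < min d1 d2"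
    have "\<bar>(f ?\<sigma> + c * g ?\<sigma>) - (f s + c * g s) - (D + c * E) * (?\<sigma> - s)\<bar>
      = \<bar>(f ?\<sigma> - f s - D * (?\<sigma> - s)) + c * (g ?\<sigma> - g s - E * (?\<sigma> - s))\<bar>"
      by (simp add: algebra_simps)
    also have "\<dots> \<le> \<bar>f ?\<sigma> - f s - D * (?\<sigma> - s)\<bar> + \<bar>c\<bar> * \<bar>g ?\<sigma> - g s - E * (?\<sigma> - s)\<bar>"
      by (metis abs_mult abs_triangle_ineq)
    also have "\<dots> \<le> e' * \<bar>?\<sigma> - s\<bar> + \<bar>c\<bar> * (e' * \<bar>?\<sigma> - s\<bar>)"
      using d1(2)[of s] d2(2)[of s] s by (intro add_mono mult_left_mono) auto
    also have "\<dots> = (e' * (1 + \<bar>c\<bar>)) * \<bar>?\<sigma> - s\<bar>" by (simp add: algebra_simps)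
    also have "e' * (1 + \<bar>c\<bar>) = e" by (simp add: e'_def add_pos_nonneg less_imp_neq[symmetric])
    finally show "\<bar>(f ?\<sigma> + c * g ?\<sigma>) - (f s + c * g s) - (D + c * E) * (?\<sigma> - s)\<bar> \<le> e * \<bar>?\<sigma> - s\<bar>" .
  qed (use d1 d2 in auto)
qed

lemma has_delta_derivative_id: "has_delta_derivative T (\<lambda>s. s) 1 t"
  unfolding has_delta_derivative_iff by (auto intro: exI[of _ 1])

text \<open>The error is exactly the product of \<open>s - t\<close> and the distance from
  \<open>s\<close> to the jump, so radius \<open>e\<close> works for tolerance
  \<open>e\<close>.\<close>

lemma has_delta_derivative_square:
  "has_delta_derivative T (\<lambda>s. s\<^sup>2) (t + fwd_jump T t) t"
  unfolding has_delta_derivative_iff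
proof (intro allI impI exI conjI ballI)
  let ?\<sigma> = "fwd_jump T t"
  fix e s :: real assume "\<bar>s - t\<bar> < e"
  have "\<bar>?\<sigma>\<^sup>2 - s\<^sup>2 - (t + ?\<sigma>) * (?\<sigma> - s)\<bar> = \<bar>(s - t) * (?\<sigma> - s)\<bar>"
    by (simp add: algebra_simps power2_eq_square)
  also have "\<dots> \<le> e * \<bar>?\<sigma> - s\<bar>"
    using \<open>\<bar>s - t\<bar> < e\<close> by (auto simp: abs_mult intro!: mult_right_mono)
  finally show "\<bar>?\<sigma>\<^sup>2 - s\<^sup>2 - (t + ?\<sigma>) * (?\<sigma> - s)\<bar> \<le> e * \<bar>?\<sigma> - s\<bar>" .
qed

lemma has_delta_derivative_Int:
  assumes "has_delta_derivative T f D t" "closed T" "b \<in> T" "a \<le> t" "t < b"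
  shows "has_delta_derivative (T \<inter> {a..b}) f D t"
  using assms(1) unfolding has_delta_derivative_iff fwd_jump_Int[OF assms(2-5)] by (meson IntD1)

text \<open>The derivative condition compares \<open>f s\<close> with the value at the jump of
  \<open>t\<close>, not with \<open>f t\<close>. Applying it at \<open>s\<close> and at
  \<open>t\<close> itself and subtracting leaves two small errors and the term
  \<open>D * (s - t)\<close>.\<close>

lemma has_delta_derivative_continuous:
  assumes "has_delta_derivative T f D t" "t \<in> T"
  shows "continuous (at t within T) f"
  unfolding continuous_within_eps_delta
proof (intro allI impI)
  let ?\<sigma> = "fwd_jump T t"
  fix e :: real assume "0 < e"
  define m where "m = \<bar>?\<sigma> - t\<bar>"
  \<comment> \<open>Within distance 1 of \<open>t\<close> the factor next to \<open>e'\<close> is at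
    most \<open>1 + m\<close>, so each of the two errors is at most \<open>e / 4\<close>; the other
    half of \<open>e\<close> is left for \<open>D * (s - t)\<close>.\<close>
  define e' where "e' = e / (4 * (1 + m))"
  have m: "0 \<le> m" by (simp add: m_def)
  have "0 < e'" using \<open>0 < e\<close> m by (auto simp: e'_def)
  then obtain d where d: "0 < d"
    "\<And>s. s \<in> T \<Longrightarrow> \<bar>s - t\<bar> < d \<Longrightarrow> \<bar>f ?\<sigma> - f s - D * (?\<sigma> - s)\<bar> \<le> e' * \<bar>?\<sigma> - s\<bar>"
    using assms(1) unfolding has_delta_derivative_iff by metis
  define d' where "d' = min d (min 1 (e / (2 * (1 + \<bar>D\<bar>))))"
  have "dist (f s) (f t) < e" if s: "s \<in> T" "dist s t < d'" for s
  proof -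
    have st: "\<bar>s - t\<bar> < d" "\<bar>s - t\<bar> < 1" "\<bar>s - t\<bar> < e / (2 * (1 + \<bar>D\<bar>))"
      using s by (auto simp: d'_def dist_real_def)
    have "\<bar>f ?\<sigma> - f s - D * (?\<sigma> - s)\<bar> \<le> e' * \<bar>?\<sigma> - s\<bar>" using d(2) s st by auto
    also have "\<dots> \<le> e' * (1 + m)"
      using st \<open>0 < e'\<close> by (intro mult_left_mono) (auto simp: m_def)
    also have "\<dots> = e / 4" using m by (simp add: e'_def field_simps)
    finally have 1: "\<bar>f ?\<sigma> - f s - D * (?\<sigma> - s)\<bar> \<le> e / 4" .
    have "\<bar>f ?\<sigma> - f t - D * (?\<sigma> - t)\<bar> \<le> e' * \<bar>?\<sigma> - t\<bar>" using d assms(2) by auto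
    also have "\<dots> \<le> e' * (1 + m)"
      using \<open>0 < e'\<close> by (intro mult_left_mono) (auto simp: m_def)
    also have "\<dots> = e / 4" using m by (simp add: e'_def field_simps)
    finally have 2: "\<bar>f ?\<sigma> - f t - D * (?\<sigma> - t)\<bar> \<le> e / 4" .
    have "\<bar>D * (s - t)\<bar> \<le> (1 + \<bar>D\<bar>) * \<bar>s - t\<bar>" by (auto simp: abs_mult intro!: mult_right_mono)
    also have "\<dots> < (1 + \<bar>D\<bar>) * (e / (2 * (1 + \<bar>D\<bar>)))"
      using st by (intro mult_strict_left_mono) auto
    also have "\<dots> = e / 2"
      by (simp add: nonzero_divide_eq_eq add_pos_nonneg less_imp_neq[symmetric] algebra_simps)
    finally have 3: "\<bar>D * (s - t)\<bar> < e / 2" .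
    have "f s - f t = (f ?\<sigma> - f t - D * (?\<sigma> - t)) - (f ?\<sigma> - f s - D * (?\<sigma> - s)) + D * (s - t)"
      by (simp add: algebra_simps)
    then show ?thesis using 1 2 3 unfolding dist_real_def by linarith
  qed
  moreover have "0 < d'" using d(1) \<open>0 < e\<close> by (auto simp: d'_def)
  ultimately show "\<exists>d>0. \<forall>s\<in>T. dist s t < d \<longrightarrow> dist (f s) (f t) < e" by blast
qed

section \<open>Points of kappa and uniqueness of the derivative\<close>

lemma kappa_subset: "kappa T \<subseteq> T"
  by (auto simp: kappa_def)

lemma kappaI:
  assumes "t \<in> T" "s \<in> T" "t < s"
  shows "t \<in> kappa T"
  using assms by (force simp: kappa_def is_maximum_def)

lemma left_scatteredD:
  assumes "left_scattered T t"
  obtains l where "l < t" "\<And>s. s \<in> T \<Longrightarrow> s < t \<Longrightarrow> s \<le> l"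
proof
  show "bwd_jump T t < t" using assms by (simp add: left_scattered_def)
  have "bdd_above {s \<in> T. s < t}" by (rule bdd_aboveI[of _ t]) auto
  then show "s \<le> bwd_jump T t" if "s \<in> T" "s < t" for s
    using that by (auto simp: bwd_jump_def intro: cSup_upper)
qed

lemma not_left_scatteredD:
  assumes "\<not> left_scattered T t" "s \<in> T" "s < t" "0 < e"
  obtains r where "r \<in> T" "r < t" "t - e < r"
proof -
  have "t - e < Sup {s \<in> T. s < t}"
    using assms by (auto simp: left_scattered_def bwd_jump_def split: if_splits)
  then obtain r where "r \<in> {s \<in> T. s < t}" "t - e < r"
    using less_cSupD[of "{s \<in> T. s < t}"] assms by auto
  then show ?thesis using that by auto
qed

text \<open>The derivative condition determines \<open>D\<close> only through points different from
  the jump of \<open>t\<close>. A right-scattered \<open>t\<close> is such a point itself; a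
  right-dense \<open>t\<close> is approached from the right, or from the left if it is the maximum,
  since it is then not left-scattered. The point \<open>s\<close> excludes a one-point time scale,
  where every number is a derivative.\<close>

lemma kappa_approach:
  assumes "t \<in> kappa T" "s \<in> T" "s \<noteq> t" "0 < e"
  obtains r where "r \<in> T" "\<bar>r - t\<bar> < e" "r \<noteq> fwd_jump T t"
proof (cases "fwd_jump T t = t")
  case False
  then show ?thesis using that[of t] assms kappa_subset by force
next
  case True
  show ?thesis
  proof (cases "\<exists>u\<in>T. t < u")
    case True
    then obtain r where "r \<in> T" "t < r" "r < t + e"
      using fwd_jump_eqD[OF \<open>fwd_jump T t = t\<close>] assms by metis
    then show ?thesis using that[of r] \<open>fwd_jump T t = t\<close> by auto
  next
    case False
    then have "\<not> left_scattered T t" "s < t"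
      using assms by (auto simp: kappa_def is_maximum_def)
    then obtain r where "r \<in> T" "r < t" "t - e < r"
      using not_left_scatteredD assms by metis
    then show ?thesis using that[of r] \<open>fwd_jump T t = t\<close> by auto
  qed
qed

lemma has_delta_derivative_unique:
  assumes D: "has_delta_derivative T f D t" and E: "has_delta_derivative T f E t"
    and t: "t \<in> kappa T" "s \<in> T" "s \<noteq> t"
  shows "D = E"
proof (rule ccontr)
  let ?\<sigma> = "fwd_jump T t"
  assume "D \<noteq> E"
  define e where "e = \<bar>D - E\<bar> / 2"
  have "0 < e" using \<open>D \<noteq> E\<close> by (simp add: e_def)
  \<comment> \<open>The zero function, written as a difference, gets derivative
    \<open>D - E\<close>. Tested at some \<open>r\<close> off the jump, this yields the absurd bound
    of \<open>\<bar>D - E\<bar>\<close> by half of itself.\<close>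
  have "has_delta_derivative T (\<lambda>s. f s + (-1) * f s) (D + (-1) * E) t"
    by (intro has_delta_derivative_lin D E)
  then obtain d where d: "0 < d"
    "\<And>s. s \<in> T \<Longrightarrow> \<bar>s - t\<bar> < d \<Longrightarrow> \<bar>(D - E) * (?\<sigma> - s)\<bar> \<le> e * \<bar>?\<sigma> - s\<bar>"
    using \<open>0 < e\<close> unfolding has_delta_derivative_iff by (auto simp: abs_mult abs_minus_commute)
  obtain r where r: "r \<in> T" "\<bar>r - t\<bar> < d" "r \<noteq> ?\<sigma>"
    using kappa_approach[OF t d(1)] by blast
  then have "\<bar>D - E\<bar> \<le> e" using d(2)[OF r(1,2)] by (simp add: abs_mult)
  then show False using \<open>D \<noteq> E\<close> by (simp add: e_def)
qed

lemma has_delta_derivative_delta_deriv: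
  assumes "delta_differentiable T f" "t \<in> kappa T" "s \<in> T" "s \<noteq> t"
  shows "has_delta_derivative T f (delta_deriv T f t) t"
proof -
  obtain D where D: "has_delta_derivative T f D t"
    using assms by (auto simp: delta_differentiable_def)
  then have "delta_deriv T f t = D"
    unfolding delta_deriv_def
    by (rule the_equality) (rule has_delta_derivative_unique[OF _ D assms(2-)])
  then show ?thesis using D by simp
qed

section \<open>Antiderivatives, mean value inequalities and the integral\<close>

lemma delta_antiderivative_lin:
  assumes "delta_antiderivative T f F" "delta_antiderivative T g G"
  shows "delta_antiderivative T (\<lambda>s. f s + c * g s) (\<lambda>s. F s + c * G s)"
  using assms by (simp add: delta_antiderivative_def has_delta_derivative_lin)

lemma delta_antiderivative_one: "delta_antiderivative T (\<lambda>_. 1) (\<lambda>s. s)"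
  by (simp add: delta_antiderivative_def has_delta_derivative_id)

text \<open>Differentiability settles the points of \<open>kappa T\<close>. The only possible other
  point is a left-scattered maximum, which is isolated.\<close>

lemma delta_antiderivative_continuous_on:
  assumes "delta_antiderivative T g G"
  shows "continuous_on T G"
  unfolding continuous_on_eq_continuous_within
proof
  fix t assume t: "t \<in> T"
  show "continuous (at t within T) G"
  proof (cases "t \<in> kappa T")
    case True
    then show ?thesis
      using assms t has_delta_derivative_continuous by (auto simp: delta_antiderivative_def)
  next
    case False
    then have "\<And>s. s \<in> T \<Longrightarrow> s \<le> t" "left_scattered T t"
      using t by (auto simp: kappa_def is_maximum_def)
    moreover then obtain l where "l < t" "\<And>s. s \<in> T \<Longrightarrow> s < t \<Longrightarrow> s \<le> l"
      using left_scatteredD by metis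
    ultimately have "s = t" if "s \<in> T" "dist s t < t - l" for s
      using that by (force simp: dist_real_def)
    then show ?thesis using \<open>l < t\<close> unfolding continuous_within_eps_delta
      by (metis diff_gt_0_iff_gt dist_self)
  qed
qed

text \<open>No derivative is required at \<open>d\<close>: there the jump operators of a time scale and of its
  intersection with an interval ending at \<open>d\<close> may differ.\<close>

lemma delta_nonneg_imp_le:
  assumes T: "closed T" "c \<in> T" "d \<in> T" "c \<le> d" and cont: "continuous_on T F"
    and der: "\<And>t. t \<in> T \<Longrightarrow> c \<le> t \<Longrightarrow> t < d \<Longrightarrow> \<exists>D\<ge>0. has_delta_derivative T F D t"
  shows "F c \<le> F d"
proof -
  have approx: "F c \<le> F d + e * (d - c)" if "0 < e" for e
  proof -
    \<comment> \<open>Continuity makes \<open>B\<close> closed, so it contains its supremum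
      \<open>s\<close>; the slack \<open>e\<close> makes it possible to find a larger element of
      \<open>B\<close> whenever \<open>s < d\<close>.\<close>
    define B where "B = {x \<in> T \<inter> {c..d}. F c \<le> F x + e * (x - c)}"
    have "continuous_on (T \<inter> {c..d}) (\<lambda>x. F x + e * (x - c))"
      by (intro continuous_intros continuous_on_subset[OF cont]) auto
    then have "closed B" unfolding B_def
      using T(1) by (intro continuous_on_closed_Collect_le) auto
    moreover have "bdd_above B" by (rule bdd_aboveI[of _ d]) (auto simp: B_def)
    moreover have "c \<in> B" using T by (auto simp: B_def)
    ultimately have sB: "Sup B \<in> B" by (intro closed_contains_Sup) auto
    define s where "s = Sup B"
    have max: "x \<le> s" if "x \<in> B" for x
      unfolding s_def using that \<open>bdd_above B\<close> by (rule cSup_upper)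
    have s: "s \<in> T" "c \<le> s" "s \<le> d" "F c \<le> F s + e * (s - c)"
      using sB by (auto simp: B_def s_def)
    have "s = d"
    proof (rule ccontr)
      assume "s \<noteq> d"
      then have "s < d" using s by simp
      let ?\<sigma> = "fwd_jump T s"
      obtain D where D: "0 \<le> D" "has_delta_derivative T F D s" using der s \<open>s < d\<close> by blast
      then obtain r where r: "0 < r"
        "\<And>u. u \<in> T \<Longrightarrow> \<bar>u - s\<bar> < r \<Longrightarrow> \<bar>F ?\<sigma> - F u - D * (?\<sigma> - u)\<bar> \<le> e * \<bar>?\<sigma> - u\<bar>"
        using \<open>0 < e\<close> unfolding has_delta_derivative_iff by metis
      \<comment> \<open>At a right-dense \<open>s\<close> the derivative condition is used at a
        nearby \<open>u\<close> to the right. At a right-scattered \<open>s\<close> it is used at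
        \<open>s\<close> itself, and the new point is the jump, which does not pass
        \<open>d\<close>.\<close>
      have "\<exists>u\<in>T. s < u \<and> u \<le> d \<and> F s \<le> F u + e * (u - s)"
      proof (cases "?\<sigma> = s")
        case True
        obtain u where u: "u \<in> T" "s < u" "u < s + min r (d - s)"
          using fwd_jump_eqD[OF True T(3) \<open>s < d\<close>, of "min r (d - s)"] r \<open>s < d\<close> by auto
        have "0 \<le> D * (u - s)" using D u by auto
        moreover have "\<bar>F s - F u - D * (s - u)\<bar> \<le> e * \<bar>s - u\<bar>"
          using r(2)[of u] u True by auto
        ultimately have "F s \<le> F u + e * (u - s)" using u by (simp add: algebra_simps)
        then show ?thesis using u by auto
      next
        case False
        then have "s < ?\<sigma>" using fwd_jump_ge[of s T] by simp
        have "0 \<le> D * (?\<sigma> - s)" using D \<open>s < ?\<sigma>\<close> by auto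
        moreover have "\<bar>F ?\<sigma> - F s - D * (?\<sigma> - s)\<bar> \<le> e * \<bar>?\<sigma> - s\<bar>"
          using r s by auto
        ultimately have "F s \<le> F ?\<sigma> + e * (?\<sigma> - s)" using \<open>s < ?\<sigma>\<close> by simp
        then show ?thesis using \<open>s < ?\<sigma>\<close> fwd_jump_in[OF T(1) s(1)] fwd_jump_le[OF T(3) \<open>s < d\<close>]
          by auto
      qed
      then obtain u where u: "u \<in> T" "s < u" "u \<le> d" "F s \<le> F u + e * (u - s)" by blast
      then have "u \<in> B" using s by (auto simp: B_def algebra_simps)
      then show False using max u by force
    qed
    then show ?thesis using s by simp
  qed
  show ?thesis
  proof (rule field_le_epsilon)
    fix e :: real assume "0 < e"
    define e' where "e' = e / (1 + (d - c))"
    have "0 < e'" using \<open>0 < e\<close> T(4) by (auto simp: e'_def)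
    have "F c \<le> F d + e' * (d - c)" by (rule approx) fact
    also have "e' * (d - c) \<le> e' * (1 + (d - c))" using \<open>0 < e'\<close> by simp
    also have "\<dots> = e" using T(4) by (simp add: e'_def)
    finally show "F c \<le> F d + e" by simp
  qed
qed

text \<open>Both bounds are monotonicity statements, for \<open>F s - l * s\<close> and for
  \<open>u * s - F s\<close>.\<close>

lemma delta_mean_value:
  assumes T: "closed T" "c \<in> T" "d \<in> T" "c \<le> d" and cont: "continuous_on T F"
    and der: "\<And>t. t \<in> T \<Longrightarrow> c \<le> t \<Longrightarrow> t < d \<Longrightarrow> \<exists>D. l \<le> D \<and> D \<le> u \<and> has_delta_derivative T F D t"
  shows "l * (d - c) \<le> F d - F c" "F d - F c \<le> u * (d - c)"
proof -
  have "F c + (- l) * c \<le> F d + (- l) * d"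
  proof (rule delta_nonneg_imp_le[OF T, of "\<lambda>s. F s + (- l) * s"])
    show "\<exists>D\<ge>0. has_delta_derivative T (\<lambda>s. F s + (- l) * s) D t" if t: "t \<in> T" "c \<le> t" "t < d" for t
    proof -
      obtain D where "l \<le> D" "has_delta_derivative T F D t" using der t by blast
      then show ?thesis
        using has_delta_derivative_lin[OF _ has_delta_derivative_id, of T F D t "- l"]
        by (intro exI[of _ "D + (- l) * 1"]) auto
    qed
  qed (intro continuous_intros cont)
  then show "l * (d - c) \<le> F d - F c" by (simp add: algebra_simps)
  have "u * c + (- 1) * F c \<le> u * d + (- 1) * F d"
  proof (rule delta_nonneg_imp_le[OF T, of "\<lambda>s. u * s + (- 1) * F s"])
    show "\<exists>D\<ge>0. has_delta_derivative T (\<lambda>s. u * s + (- 1) * F s) D t" if t: "t \<in> T" "c \<le> t" "t < d" for t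
    proof -
      obtain D where D: "D \<le> u" "has_delta_derivative T F D t" using der t by blast
      have "has_delta_derivative T (\<lambda>s. 0 + u * s) (0 + u * 1) t"
        by (intro has_delta_derivative_lin has_delta_derivative_id)
           (auto simp: has_delta_derivative_iff intro: exI[of _ 1])
      from has_delta_derivative_lin[OF this D(2), of "- 1"] show ?thesis
        using D by (intro exI[of _ "(0 + u * 1) + (- 1) * D"]) auto
    qed
  qed (intro continuous_intros cont)
  then show "F d - F c \<le> u * (d - c)" by (simp add: algebra_simps)
qed

text \<open>Two antiderivatives differ by a function with derivative 0, which is constant by the
  mean value inequalities with both bounds 0. This identifies the value chosen by
  \<open>THE\<close>, in either order of \<open>c\<close> and \<open>d\<close>.\<close>

lemma delta_integral_eq:
  assumes T: "closed T" "c \<in> T" "d \<in> T" and G: "delta_antiderivative T g G"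
  shows "delta_integral T g c d = G d - G c"
  unfolding delta_integral_def
proof (rule the_equality)
  show "\<exists>H. delta_antiderivative T g H \<and> G d - G c = H d - H c" using G by blast
next
  fix I assume "\<exists>H. delta_antiderivative T g H \<and> I = H d - H c"
  then obtain H where H: "delta_antiderivative T g H" "I = H d - H c" by blast
  define F where "F = (\<lambda>s. H s + (- 1) * G s)"
  have F: "delta_antiderivative T (\<lambda>s. g s + (- 1) * g s) F"
    unfolding F_def by (intro delta_antiderivative_lin H G)
  have eq: "F x = F y" if xy: "x \<in> T" "y \<in> T" "x \<le> y" for x y
  proof -
    have "\<exists>D. 0 \<le> D \<and> D \<le> 0 \<and> has_delta_derivative T F D t" if "t \<in> T" "x \<le> t" "t < y" for t
      using F kappaI[OF that(1) xy(2) that(3)] by (auto simp: delta_antiderivative_def)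
    from delta_mean_value[OF T(1) xy delta_antiderivative_continuous_on[OF F] this]
    show ?thesis by simp
  qed
  have "F c = F d" using eq[OF T(2,3)] eq[OF T(3,2)] by linarith
  then show "I = G d - G c" using H by (simp add: F_def)
qed

section \<open>Antiderivatives of nondecreasing functions\<close>

text \<open>Composing \<open>g\<close> with this map extends it to the gaps of \<open>T\<close> as a
  step function: from \<open>t\<close> up to its jump the value stays \<open>g t\<close>. The
  ordinary integral over a gap is then \<open>g t\<close> times its length, as the delta integral
  demands.\<close>

definition ts_floor :: "real set \<Rightarrow> real \<Rightarrow> real" where
  "ts_floor T x = Sup (T \<inter> {..x})"

lemma ts_floor:
  assumes "closed T" "s \<in> T" "s \<le> x"
  shows "ts_floor T x \<in> T" "s \<le> ts_floor T x" "ts_floor T x \<le> x"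
proof -
  have bdd: "bdd_above (T \<inter> {..x})" by (rule bdd_aboveI[of _ x]) auto
  have "Sup (T \<inter> {..x}) \<in> T \<inter> {..x}"
    using assms bdd by (intro closed_contains_Sup) auto
  then show "ts_floor T x \<in> T" "ts_floor T x \<le> x" by (auto simp: ts_floor_def)
  show "s \<le> ts_floor T x" unfolding ts_floor_def using assms bdd by (intro cSup_upper) auto
qed

lemma ts_floor_gap:
  assumes "closed T" "t \<in> T" "t \<le> x" "x < fwd_jump T t"
  shows "ts_floor T x = t"
proof (rule ccontr)
  assume "ts_floor T x \<noteq> t"
  then have "fwd_jump T t \<le> ts_floor T x"
    using ts_floor[OF assms(1-3)] by (intro fwd_jump_le) auto
  then show False using ts_floor[OF assms(1-3)] assms by simp
qed

text \<open>The half-line starts at a point of \<open>T\<close>, so that the supremum is over a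
  nonempty set.\<close>

lemma mono_on_ts_floor:
  assumes "closed T" "mono_on T g" "s \<in> T"
  shows "mono_on {s..} (\<lambda>x. g (ts_floor T x))"
proof (intro mono_onI)
  fix x y assume xy: "x \<in> {s..}" "y \<in> {s..}" "x \<le> y"
  have x: "ts_floor T x \<in> T" "ts_floor T x \<le> y" "s \<le> x"
    using ts_floor[OF assms(1,3), of x] xy by auto
  have "ts_floor T x \<le> ts_floor T y" by (rule ts_floor[OF assms(1) x(1,2)])
  then show "g (ts_floor T x) \<le> g (ts_floor T y)"
    using mono_onD[OF assms(2)] x(1) ts_floor(1)[OF assms(1) x(1,2)] by blast
qed

text \<open>Monotonicity gives integrability of the step extension and traps the increment of
  \<open>G\<close> from \<open>s\<close> to \<open>t\<close> between \<open>g s * (t - s)\<close>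
  and \<open>g t * (t - s)\<close>. Continuity of \<open>g\<close> is used only where
  \<open>t\<close> equals its jump.\<close>

lemma delta_antiderivative_mono_exists:
  assumes T: "closed T" and g: "mono_on T g"
    and cont: "\<And>t. t \<in> T \<Longrightarrow> fwd_jump T t = t \<Longrightarrow> continuous (at t within T) g"
  obtains G where "delta_antiderivative T g G"
proof (cases "T = {}")
  case True
  then show ?thesis using that by (auto simp: delta_antiderivative_def kappa_def)
next
  case False
  then obtain a where a: "a \<in> T" by blast
  define q where "q = (\<lambda>x. g (ts_floor T x))"
  \<comment> \<open>A signed integral from the base point \<open>a\<close>: at most one of the two
    intervals is nondegenerate, so points on both sides of \<open>a\<close> are covered.\<close>
  define G where "G = (\<lambda>x. integral {a..x} q - integral {x..a} q)"
  have int: "q integrable_on {s..t}" if "s \<in> T" for s t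
    using mono_on_subset[OF mono_on_ts_floor[OF T g that], of "{s..t}"]
    unfolding q_def by (intro integrable_on_mono_on) auto
  have G: "G t - G s = integral {s..t} q" if st: "s \<in> T" "t \<in> T" "s \<le> t" for s t
  proof -
    consider "a \<le> s" | "s \<le> a" "a \<le> t" | "t \<le> a" by linarith
    then show ?thesis
    proof cases
      case 1
      have "integral {a..s} q + integral {s..t} q = integral {a..t} q"
        using 1 st int[OF a] by (intro Henstock_Kurzweil_Integration.integral_combine) auto
      moreover have "integral {s..a} q = 0" "integral {t..a} q = 0"
        using 1 st by (cases "s = a"; cases "t = a"; simp)+
      ultimately show ?thesis by (simp add: G_def)
    next
      case 2
      have "integral {s..a} q + integral {a..t} q = integral {s..t} q"
        using 2 st int by (intro Henstock_Kurzweil_Integration.integral_combine) auto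
      moreover have "integral {t..a} q = 0" "integral {a..s} q = 0"
        using 2 by (cases "s = a"; cases "t = a"; simp)+
      ultimately show ?thesis by (simp add: G_def)
    next
      case 3
      have "integral {s..t} q + integral {t..a} q = integral {s..a} q"
        using 3 st int by (intro Henstock_Kurzweil_Integration.integral_combine) auto
      moreover have "integral {a..s} q = 0" "integral {a..t} q = 0"
        using 3 st by (cases "s = a"; cases "t = a"; simp)+
      ultimately show ?thesis by (simp add: G_def)
    qed
  qed
  have between: "g s \<le> q x" "q x \<le> g t" if "s \<in> T" "t \<in> T" "s \<le> x" "x \<le> t" for s t x
    using that ts_floor[OF T, of s x] mono_onD[OF g] unfolding q_def by auto
  have G_bounds: "g s * (t - s) \<le> G t - G s" "G t - G s \<le> g t * (t - s)"
    if st: "s \<in> T" "t \<in> T" "s \<le> t" for s t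
  proof -
    have "integral {s..t} (\<lambda>_. g s) \<le> integral {s..t} q"
      using st int between by (intro integral_le) auto
    then show "g s * (t - s) \<le> G t - G s" using G[OF st] st by (simp add: mult.commute)
    have "integral {s..t} q \<le> integral {s..t} (\<lambda>_. g t)"
      using st int between by (intro integral_le) auto
    then show "G t - G s \<le> g t * (t - s)" using G[OF st] st by (simp add: mult.commute)
  qed
  \<comment> \<open>On a gap the integrand is constant except possibly at the right end point, which
    is negligible.\<close>
  have G_jump: "G (fwd_jump T t) - G t = g t * (fwd_jump T t - t)" if t: "t \<in> T" for t
  proof -
    have "integral {t..fwd_jump T t} q = integral {t..fwd_jump T t} (\<lambda>_. g t)"
      by (rule integral_spike[of "{fwd_jump T t}"])
         (auto simp: q_def ts_floor_gap[OF T t])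
    then show ?thesis
      using G[OF t fwd_jump_in[OF T t] fwd_jump_ge] fwd_jump_ge[of t T] by (simp add: mult.commute)
  qed
  have "has_delta_derivative T G (g t) t" if t: "t \<in> T" for t
    unfolding has_delta_derivative_iff
  proof (intro allI impI)
    let ?\<sigma> = "fwd_jump T t"
    fix e :: real assume e: "0 < e"
    \<comment> \<open>By \<open>G_jump\<close> the error measured from the jump equals the error
      measured from \<open>t\<close>, which the trapping bounds control.\<close>
    have bound: "\<bar>G ?\<sigma> - G s - g t * (?\<sigma> - s)\<bar> \<le> \<bar>g t - g s\<bar> * \<bar>t - s\<bar>" if s: "s \<in> T" for s
    proof -
      have "\<bar>G t - G s - g t * (t - s)\<bar> \<le> \<bar>g t - g s\<bar> * \<bar>t - s\<bar>"
      proof (cases "s \<le> t")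
        case True
        then show ?thesis using G_bounds[OF s t] mono_onD[OF g s t]
          by (auto simp: algebra_simps)
      next
        case False
        then show ?thesis using G_bounds[OF t s] mono_onD[OF g t s]
          by (auto simp: algebra_simps abs_if)
      qed
      moreover have "G ?\<sigma> - G s - g t * (?\<sigma> - s) = G t - G s - g t * (t - s)"
        using G_jump[OF t] by (simp add: algebra_simps)
      ultimately show ?thesis by simp
    qed
    show "\<exists>d>0. \<forall>s\<in>T. \<bar>s - t\<bar> < d \<longrightarrow> \<bar>G ?\<sigma> - G s - g t * (?\<sigma> - s)\<bar> \<le> e * \<bar>?\<sigma> - s\<bar>"
    proof (cases "?\<sigma> = t")
      case True
      then obtain d where d: "0 < d" "\<And>s. s \<in> T \<Longrightarrow> \<bar>s - t\<bar> < d \<Longrightarrow> \<bar>g s - g t\<bar> < e"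
        using cont[OF t True] e unfolding continuous_within_eps_delta dist_real_def by metis
      have "\<bar>G ?\<sigma> - G s - g t * (?\<sigma> - s)\<bar> \<le> e * \<bar>?\<sigma> - s\<bar>" if s: "s \<in> T" "\<bar>s - t\<bar> < d" for s
      proof -
        have "\<bar>g t - g s\<bar> * \<bar>t - s\<bar> \<le> e * \<bar>t - s\<bar>"
          using d(2)[OF s] by (intro mult_right_mono) auto
        then show ?thesis using bound[OF s(1)] True by simp
      qed
      then show ?thesis using d(1) by blast
    next
      case False
      define m where "m = ?\<sigma> - t"
      have m: "0 < m" using False fwd_jump_ge[of t T] by (simp add: m_def)
      \<comment> \<open>At a right-scattered \<open>t\<close>, \<open>g\<close> may be discontinuous
        from the left, but the permitted error stays at least \<open>e * m\<close> for
        \<open>s \<le> t\<close>, so local boundedness of \<open>g\<close> suffices. A lower bound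
        comes from a point of \<open>T\<close> below \<open>t - 1\<close> or, failing that, from the
        minimum of \<open>T\<close>.\<close>
      obtain C where C: "0 < C" "\<And>s. s \<in> T \<Longrightarrow> s \<le> t \<Longrightarrow> \<bar>s - t\<bar> < 1 \<Longrightarrow> \<bar>g t - g s\<bar> \<le> C"
      proof (cases "\<exists>r\<in>T. r \<le> t - 1")
        case True
        then obtain r where r: "r \<in> T" "r \<le> t - 1" by blast
        show ?thesis
        proof (rule that[of "1 + (g t - g r)"])
          show "0 < 1 + (g t - g r)" using mono_onD[OF g r(1) t] r by simp
          show "\<bar>g t - g s\<bar> \<le> 1 + (g t - g r)" if "s \<in> T" "s \<le> t" "\<bar>s - t\<bar> < 1" for s
            using mono_onD[OF g r(1) that(1)] mono_onD[OF g that(1) t] that r by simp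
        qed
      next
        case False
        then have "bdd_below T" by (intro bdd_belowI[of _ "t - 1"]) force
        then have r: "Inf T \<in> T" "\<And>s. s \<in> T \<Longrightarrow> Inf T \<le> s"
          using closed_contains_Inf[OF _ _ T] t by (auto intro: cInf_lower)
        show ?thesis
        proof (rule that[of "1 + (g t - g (Inf T))"])
          show "0 < 1 + (g t - g (Inf T))" using mono_onD[OF g r(1) t] r(2)[OF t] by simp
          show "\<bar>g t - g s\<bar> \<le> 1 + (g t - g (Inf T))" if "s \<in> T" "s \<le> t" "\<bar>s - t\<bar> < 1" for s
            using mono_onD[OF g r(1) that(1)] mono_onD[OF g that(1) t] that r by simp
        qed
      qed
      \<comment> \<open>Radius \<open>m\<close> forces \<open>s \<le> t\<close>, radius 1 gives
        access to the bound \<open>C\<close>, and the last entry makes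
        \<open>C * \<bar>t - s\<bar>\<close> at most \<open>e * m\<close>.\<close>
      define d where "d = min m (min 1 (e * m / C))"
      have "\<bar>G ?\<sigma> - G s - g t * (?\<sigma> - s)\<bar> \<le> e * \<bar>?\<sigma> - s\<bar>" if s: "s \<in> T" "\<bar>s - t\<bar> < d" for s
      proof -
        have sd: "\<bar>s - t\<bar> < m" "\<bar>s - t\<bar> < 1" "\<bar>s - t\<bar> < e * m / C" using s by (auto simp: d_def)
        have "s \<le> t"
          using fwd_jump_le[OF s(1), of t] sd(1) unfolding m_def by linarith
        have "\<bar>g t - g s\<bar> * \<bar>t - s\<bar> \<le> C * (e * m / C)"
          using C sd s \<open>s \<le> t\<close> by (intro mult_mono) auto
        also have "\<dots> = e * m" using C by simp
        also have "\<dots> \<le> e * \<bar>?\<sigma> - s\<bar>"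
          using e \<open>s \<le> t\<close> by (intro mult_left_mono) (auto simp: m_def)
        finally show ?thesis using bound[OF s(1)] by simp
      qed
      moreover have "0 < d" using m e C by (auto simp: d_def)
      ultimately show ?thesis by blast
    qed
  qed
  then show ?thesis using that kappa_subset unfolding delta_antiderivative_def by blast
qed

section \<open>The functions h_1 and h_2\<close>

lemma ts_h_1:
  assumes "closed T" "s \<in> T" "t \<in> T"
  shows "ts_h T (Suc 0) t s = t - s"
  using delta_integral_eq[OF assms delta_antiderivative_one] by simp

text \<open>An antiderivative \<open>H\<close> of the identity stands in for a closed form. In the
  difference of two such values with the same \<open>t\<close>, the term \<open>H t\<close>
  cancels.\<close>

lemma ts_h_2:
  assumes T: "closed T" "s \<in> T" "t \<in> T" and H: "delta_antiderivative T (\<lambda>\<tau>. \<tau>) H"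
  shows "ts_h T 2 t s = H t - H s - s * (t - s)"
proof -
  have "delta_antiderivative T (\<lambda>\<tau>. \<tau> + (- s) * 1) (\<lambda>\<tau>. H \<tau> + (- s) * \<tau>)"
    by (intro delta_antiderivative_lin H delta_antiderivative_one)
  then have "delta_antiderivative T (\<lambda>\<tau>. ts_h T (Suc 0) \<tau> s) (\<lambda>\<tau>. H \<tau> + (- s) * \<tau>)"
    using kappa_subset[of T] ts_h_1[OF T(1,2)] unfolding delta_antiderivative_def
    by (auto simp del: ts_h.simps)
  from delta_integral_eq[OF T this] show ?thesis
    by (simp add: numeral_2_eq_2 algebra_simps)
qed

section \<open>The Ostrowski-type inequality\<close>

theorem theorem4:
  fixes T :: "real set" and f :: "real \<Rightarrow> real" and a b \<gamma> \<Gamma> :: real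
  assumes "time_scale T"
    and "a \<in> T" and "b \<in> T" and "a < b"
    and "delta_differentiable (T \<inter> {a..b}) f"
    and "rd_continuous_on (T \<inter> {a..b}) (kappa (T \<inter> {a..b})) (delta_deriv (T \<inter> {a..b}) f)"
    and "\<forall>t \<in> kappa (T \<inter> {a..b}).
           \<gamma> \<le> delta_deriv (T \<inter> {a..b}) f t \<and> delta_deriv (T \<inter> {a..b}) f t \<le> \<Gamma>"
  shows "\<forall>t \<in> T \<inter> {a..b}.
    \<bar>f t
      - 1 / (b - a) * delta_integral (T \<inter> {a..b}) (\<lambda>s. f (fwd_jump (T \<inter> {a..b}) s)) a b
      - (f b - f a) / (b - a)\<^sup>2 * (ts_h T 2 t a - ts_h T 2 t b)\<bar>
    \<le> 1 / 4 * (b - a) * (\<Gamma> - \<gamma>)"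
proof
  define S where "S = T \<inter> {a..b}"
  define L where "L = b - a"
  define m where "m = (f b - f a) / L"
  define K where "K = 1 / 4 * L * (\<Gamma> - \<gamma>)"
  fix t assume "t \<in> T \<inter> {a..b}"
  then have t: "t \<in> S" "t \<in> T" by (auto simp: S_def)
  have T: "closed T" using assms(1) by (simp add: time_scale_def)
  then have S: "closed S" "a \<in> S" "b \<in> S" using assms by (auto simp: S_def)
  have L: "0 < L" using assms by (simp add: L_def)
  note bnd = assms(7)[folded S_def]
  have f: "delta_antiderivative S (delta_deriv S f) f"
    unfolding delta_antiderivative_def
  proof
    fix x assume "x \<in> kappa S"
    \<comment> \<open>Uniqueness of the derivative needs a second point of \<open>S\<close>:
      \<open>b\<close> if \<open>x = a\<close>, and \<open>a\<close> otherwise.\<close>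
    then show "has_delta_derivative S f (delta_deriv S f x) x"
      using has_delta_derivative_delta_deriv[OF assms(5)[folded S_def], of x a]
        has_delta_derivative_delta_deriv[OF assms(5)[folded S_def], of x b] S assms(4)
      by (cases "x = a") auto
  qed
  note fcont = delta_antiderivative_continuous_on[OF f]
  have slope: "\<gamma> * (y - x) \<le> f y - f x" "f y - f x \<le> \<Gamma> * (y - x)"
    if xy: "x \<in> S" "y \<in> S" "x \<le> y" for x y
  proof -
    have "\<exists>D. \<gamma> \<le> D \<and> D \<le> \<Gamma> \<and> has_delta_derivative S f D u" if "u \<in> S" "x \<le> u" "u < y" for u
      using f bnd kappaI[OF that(1) xy(2) that(3)] unfolding delta_antiderivative_def by blast
    from delta_mean_value[OF S(1) xy fcont this]
    show "\<gamma> * (y - x) \<le> f y - f x" "f y - f x \<le> \<Gamma> * (y - x)" by blast+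
  qed

  obtain F where F: "delta_antiderivative S (\<lambda>s. f (fwd_jump S s)) F"
  proof -
    let ?k = "\<lambda>s. f s + (- \<gamma>) * s"
    have jump: "fwd_jump S ` S \<subseteq> S" using fwd_jump_in[OF S(1)] by blast
    obtain F where F: "delta_antiderivative S (\<lambda>s. ?k (fwd_jump S s)) F"
    proof (rule delta_antiderivative_mono_exists[OF S(1)])
      show "mono_on S (\<lambda>s. ?k (fwd_jump S s))"
      proof (rule mono_onI)
        fix r s assume "r \<in> S" "s \<in> S" "r \<le> s"
        then show "?k (fwd_jump S r) \<le> ?k (fwd_jump S s)"
          using slope(1)[of "fwd_jump S r" "fwd_jump S s"] fwd_jump_mono[OF S(1)] jump
          by (auto simp: algebra_simps)
      qed
      show "continuous (at s within S) (\<lambda>s. ?k (fwd_jump S s))"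
        if s: "s \<in> S" "fwd_jump S s = s" for s
      proof -
        have "continuous_on S ?k" by (intro continuous_intros fcont)
        then have "continuous (at s within fwd_jump S ` S) ?k"
          using s jump continuous_within_subset
          unfolding continuous_on_eq_continuous_within by blast
        then show ?thesis
          using continuous_within_compose2[OF continuous_fwd_jump[OF S(1) s]] s(2) by simp
      qed
    qed blast
    obtain H where H: "delta_antiderivative S (\<lambda>s. s) H"
      by (rule delta_antiderivative_mono_exists[OF S(1), of "\<lambda>s. s"])
         (auto intro: mono_onI)
    have sq: "delta_antiderivative S (\<lambda>s. s + fwd_jump S s) (\<lambda>s. s\<^sup>2)"
      by (simp add: delta_antiderivative_def has_delta_derivative_square)
    \<comment> \<open>Undoes the subtraction of \<open>\<gamma> * s\<close>: the jump of
      \<open>s\<close> is \<open>s\<close> plus its jump, minus \<open>s\<close>, and so has the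
      antiderivative \<open>s\<^sup>2 - H s\<close>.\<close>
    have "delta_antiderivative S (\<lambda>s. ?k (fwd_jump S s) + \<gamma> * ((s + fwd_jump S s) + (- 1) * s))
        (\<lambda>s. F s + \<gamma> * (s\<^sup>2 + (- 1) * H s))"
      by (intro delta_antiderivative_lin F H sq)
    then show ?thesis using that by (simp add: algebra_simps)
  qed
  have intF: "delta_integral S (\<lambda>s. f (fwd_jump S s)) a b = F b - F a"
    by (rule delta_integral_eq[OF S F])

  \<comment> \<open>This \<open>H\<close> lives on \<open>T\<close>, not on \<open>S\<close>,
    because the functions \<open>ts_h\<close> of the claim are taken over \<open>T\<close>.\<close>
  obtain H where H: "delta_antiderivative T (\<lambda>s. s) H"
    by (rule delta_antiderivative_mono_exists[OF T, of "\<lambda>s. s"]) (auto intro: mono_onI)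
  define k where "k = (\<lambda>s. f s - m * s)"
  \<comment> \<open>Built so that its derivative on \<open>S\<close> at every \<open>s < b\<close>
    is \<open>k\<close> at the jump of \<open>s\<close>; its increment over the interval divided by
    \<open>L\<close> is the average to be compared with \<open>k t\<close>.\<close>
  define P where "P = (\<lambda>s. F s + (- m) * (s\<^sup>2 + (- 1) * H s))"
  have kab: "f b - f a = m * L" using L by (simp add: m_def)

  have osc: "k x - k y \<le> K" if xy: "x \<in> S" "y \<in> S" for x y
  proof -
    let ?d = "k x - k y"
    have "\<exists>u. 0 \<le> u \<and> u \<le> L \<and> ?d * L \<le> (\<Gamma> - \<gamma>) * (u * (L - u))"
    proof (cases "x \<le> y")
      case True
      define u where "u = y - x"
      have u: "0 \<le> u" "u \<le> L" using True xy by (auto simp: u_def L_def S_def)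
      have "?d \<le> (m - \<gamma>) * u"
        using slope[OF xy True] by (simp add: k_def u_def algebra_simps)
      \<comment> \<open>The complementary arc consists of the pieces from \<open>a\<close> to
        \<open>x\<close> and from \<open>y\<close> to \<open>b\<close>, glued by
        \<open>k a = k b\<close>, which enters through \<open>kab\<close>.\<close>
      moreover have "?d \<le> (\<Gamma> - m) * (L - u)"
        using slope(2)[of a x] slope(2)[of y b] xy S kab
        by (auto simp: k_def u_def L_def S_def algebra_simps)
      \<comment> \<open>Each bound is weighted by the length of the other arc, so that
        \<open>m\<close> drops out and \<open>\<Gamma> - \<gamma>\<close> remains.\<close>
      ultimately have "?d * (L - u) + ?d * u
          \<le> (m - \<gamma>) * u * (L - u) + (\<Gamma> - m) * (L - u) * u"
        using u by (intro add_mono mult_right_mono) auto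
      then show ?thesis using u by (intro exI[of _ u]) (simp add: algebra_simps)
    next
      case False
      define u where "u = x - y"
      have u: "0 \<le> u" "u \<le> L" using False xy by (auto simp: u_def L_def S_def)
      have "?d \<le> (\<Gamma> - m) * u"
        using slope(2)[OF xy(2,1)] False by (simp add: k_def u_def algebra_simps)
      moreover have "?d \<le> (m - \<gamma>) * (L - u)"
        using slope(1)[of a y] slope(1)[of x b] xy S kab
        by (auto simp: k_def u_def L_def S_def algebra_simps)
      ultimately have "?d * (L - u) + ?d * u
          \<le> (\<Gamma> - m) * u * (L - u) + (m - \<gamma>) * (L - u) * u"
        using u by (intro add_mono mult_right_mono) auto
      then show ?thesis using u by (intro exI[of _ u]) (simp add: algebra_simps)
    qed
    then obtain u where u: "?d * L \<le> (\<Gamma> - \<gamma>) * (u * (L - u))" by blast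
    have "0 \<le> (\<Gamma> - \<gamma>) * L" using slope[OF S(2,3)] assms(4) by (simp add: L_def algebra_simps)
    then have "0 \<le> \<Gamma> - \<gamma>" using L by (simp add: zero_le_mult_iff)
    moreover have "u * (L - u) \<le> L\<^sup>2 / 4"
      using zero_le_power2[of "L / 2 - u"] by (simp add: power2_eq_square algebra_simps)
    ultimately have "(\<Gamma> - \<gamma>) * (u * (L - u)) \<le> (\<Gamma> - \<gamma>) * (L\<^sup>2 / 4)"
      by (rule mult_left_mono[rotated])
    with u have "?d * L \<le> K * L" by (simp add: K_def power2_eq_square algebra_simps)
    then show ?thesis using L by simp
  qed

  have Pcont: "continuous_on S P"
    unfolding P_def using delta_antiderivative_continuous_on[OF F]
      continuous_on_subset[OF delta_antiderivative_continuous_on[OF H], of S]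
    by (intro continuous_intros) (auto simp: S_def)
  \<comment> \<open>The witness is \<open>k\<close> at the jump of \<open>s\<close>, within
    \<open>K\<close> of \<open>k t\<close> by \<open>osc\<close> used in both directions. The
    condition \<open>s < b\<close> allows the derivative of \<open>H\<close> to pass from
    \<open>T\<close> to \<open>S\<close>.\<close>
  have Pder: "\<exists>D. k t - K \<le> D \<and> D \<le> k t + K \<and> has_delta_derivative S P D s"
    if s: "s \<in> S" "a \<le> s" "s < b" for s
  proof -
    let ?\<sigma> = "fwd_jump S s"
    have sk: "s \<in> kappa S" "s \<in> kappa T" "?\<sigma> \<in> S"
      using kappaI[OF s(1) S(3) s(3)] kappaI[of s T b] s assms(3) fwd_jump_in[OF S(1) s(1)]
      by (auto simp: S_def)
    have "has_delta_derivative S H s s"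
      unfolding S_def using H sk s assms(3) T
      by (intro has_delta_derivative_Int) (auto simp: delta_antiderivative_def)
    moreover have "has_delta_derivative S F (f ?\<sigma>) s"
      using F sk by (simp add: delta_antiderivative_def)
    ultimately have "has_delta_derivative S P (f ?\<sigma> + (- m) * ((s + ?\<sigma>) + (- 1) * s)) s"
      unfolding P_def by (intro has_delta_derivative_lin has_delta_derivative_square)
    moreover have "f ?\<sigma> + (- m) * ((s + ?\<sigma>) + (- 1) * s) = k ?\<sigma>" by (simp add: k_def)
    ultimately show ?thesis using osc[OF t(1) sk(3)] osc[OF sk(3) t(1)]
      by (intro exI[of _ "k ?\<sigma>"]) auto
  qed
  have ab: "a \<le> b" using assms(4) by simp
  have "(k t - K) * L \<le> P b - P a" "P b - P a \<le> (k t + K) * L"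
    using delta_mean_value[OF S ab Pcont Pder] by (simp_all add: L_def)
  then have "k t - K \<le> (P b - P a) / L" "(P b - P a) / L \<le> k t + K"
    using L by (simp_all add: field_simps)
  then have "\<bar>k t - (P b - P a) / L\<bar> \<le> K" by linarith
  moreover have "f t - 1 / L * (F b - F a) - (f b - f a) / L\<^sup>2 * (ts_h T 2 t a - ts_h T 2 t b)
      = k t - (P b - P a) / L"
  proof -
    \<comment> \<open>Multiplied by \<open>m / L\<close>, the term \<open>t * L\<close> turns
      \<open>f t\<close> into \<open>k t\<close>, and the other terms correct
      \<open>F b - F a\<close> to \<open>P b - P a\<close>.\<close>
    have "ts_h T 2 t a - ts_h T 2 t b = H b - H a + t * L + a\<^sup>2 - b\<^sup>2"
      using ts_h_2[OF T assms(2) t(2) H] ts_h_2[OF T assms(3) t(2) H]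
      by (simp add: L_def power2_eq_square algebra_simps)
    moreover have "(f b - f a) / L\<^sup>2 = m / L" by (simp add: m_def power2_eq_square)
    moreover have "P b - P a = F b - F a - m * (b\<^sup>2 - a\<^sup>2 - (H b - H a))"
      by (simp add: P_def algebra_simps)
    ultimately have "f t - 1 / L * (F b - F a) - (f b - f a) / L\<^sup>2 * (ts_h T 2 t a - ts_h T 2 t b)
        = f t - 1 / L * (F b - F a) - m / L * (H b - H a + t * L + a\<^sup>2 - b\<^sup>2)"
      and "k t - (P b - P a) / L
        = f t - m * t - (F b - F a - m * (b\<^sup>2 - a\<^sup>2 - (H b - H a))) / L"
      by (simp_all only: k_def)
    moreover have "f t - 1 / L * (F b - F a) - m / L * (H b - H a + t * L + a\<^sup>2 - b\<^sup>2)
        = f t - m * t - (F b - F a - m * (b\<^sup>2 - a\<^sup>2 - (H b - H a))) / L"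
      using L by (simp add: field_simps)
    ultimately show ?thesis by simp
  qed
  ultimately show "\<bar>f t
      - 1 / (b - a) * delta_integral (T \<inter> {a..b}) (\<lambda>s. f (fwd_jump (T \<inter> {a..b}) s)) a b
      - (f b - f a) / (b - a)\<^sup>2 * (ts_h T 2 t a - ts_h T 2 t b)\<bar>
    \<le> 1 / 4 * (b - a) * (\<Gamma> - \<gamma>)"
    using intF by (simp add: S_def L_def K_def)
qed

end
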